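(* Let $k\ge 1$, $r\ge 2$, $n=k+r$, and let $(I_n,\mathcal{A})$ be an $(n,r,\lambda)$-BIBD with $I_n=\{1,\dots,n\}$ and $\mathcal{A}=\{A_1,\dots,A_b\}$. Let $\mathcal{D}$ be the $(b\cdot r)$-piggybacked $(n=k+r,k)$ MSR code constructed from this BIBD and from $b$ instances of an $r$-piggybacked $(k+r,k)$ MSR code as described in the context, and let $\alpha$ be the amount of data stored in each node of $\mathcal{D}$. Then $\mathcal{D}$ has the balanced download property: whichever single node fails, it can be repaired by having each of the $n-1$ surviving nodes transmit the same amount of data $$\beta=\left(\frac{(r-1)^2}{n(n-1)}+\frac1r\right)\alpha ,$$ which is $\left(1+\frac{r(r-1)^2}{n(n-1)}\right)$ times the optimal amount $\alpha/r$.
   Context: All data are vectors over a fixed finite field $\mathbb{F}$, and amounts of data are counted in symbols of $\mathbb{F}$. BIBD: an $(n,r,\lambda)$-BIBD (balanced incomplete block design) is a pair $(I_n,\mathcal{A})$ where $I_n$ is an $n$-set and $\mathcal{A}$ is a collection of $b$ $r$-subsets of $I_n$ (blocks) such that each element of $I_n$ lies in exactly $e$ blocks and any $2$-subset of $I_n$ is contained in exactly $\lambda$ blocks. Here $e=\frac{\lambda(n-1)}{r-1}$ and $b=\frac{\lambda n(n-1)}{r(r-1)}$, with $\lambda\ge1$. Systematic $(k+r,k)$ MSR code with node size $a$ (where $r\mid a$): there are $k$ systematic nodes storing arbitrary data vectors $\mathbf{f}_1,\dots,\mathbf{f}_k\in\mathbb{F}^{a}$, and $r$ parity nodes, the $j$th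 one storing $\mathbf{f}_{k+j}=\sum_{i=1}^k C_{j,i}\mathbf{f}_i$ for fixed $a\times a$ matrices $C_{j,i}$ over $\mathbb{F}$. It is assumed that: (a) (MDS property) the contents of any $k$ of the $k+r$ nodes determine $\mathbf{f}_1,\dots,\mathbf{f}_k$; (b) for each $1\le i\le k$ there is an $\frac{a}{r}\times a$ repair matrix $S_i$ of rank $a/r$, depending only on $i$, such that $\mathbf{f}_i$ is determined by the data $S_i\mathbf{f}_j$, $1\le j\le k+r$, $j\neq i$. $r$-piggybacked $(k+r,k)$ MSR code: take $r$ independent instances of such an MSR code, and let $\mathbf{f}_j^{(m)}$ be the content of node $j$ in instance $m$ ($1\le m\le r$). For each $1\le i\le r$ let $p_i:\{1,\dots,r\}\to\{1,\dots,r\}$ be injective with $p_i(r)=i$, chosen so that the sets $T_l=\{(i',j') : p_{i'}(j')=l,\ 1\le i'\le r,\ 1\le j'<r\}$ satisfy $|T_l|=r-1$ for all $1\le l\le r$. Let $\mathbf{P}_l=\sum_{(i',j')\in T_l}\mathbf{f}_{k+i'}^{(j')}$. Systematic node $j$ stores $(\mathbf{f}_j^{(1)},\dots,\mathbf{f}_j^{(r)})$ and parity node $l$ stores $(\mathbf{f}_{k+l}^{(1)},\dots,\mathbf{f}_{k+l}^{(r-1)},\mathbf{f}_{k+l}^{(r)}+\mathbf{P}_l)$. Its node size is $\alpha'=ra$. Construction of $\mathcal{D}$ (on nodes $1,\dots,n$): generate $b$ independent instances of the $r$-piggybacked $(k+r,k)$ MSR code. For each $1\le i\le b$, place the contents of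 the $r$ parity nodes of the $i$th instance on the $r$ nodes in $A_i$ (one on each), and the contents of the $k$ systematic nodes of the $i$th instance on the $k$ nodes in $I_n\setminus A_i$ (one on each). Each node of $\mathcal{D}$ thus stores $\alpha=b\alpha'$ symbols. Repair: a failed node is repaired by downloading from each surviving node symbols that are linear functions of that node's content, and recovering the entire content of the failed node from all downloaded symbols. The optimal amount per surviving node for an MSR code of node size $\alpha$ with all $n-1$ surviving nodes helping is $\alpha/r$. *)

theory Defs
  imports "Jordan_Normal_Form.DL_Rank" "HOL-Library.FuncSet"
begin

text \<open>Everything is indexed from 1 (nodes, instances, blocks), except the coordinates of the
  library's vectors and matrices.\<close>

section \<open>Block designs\<close>

text \<open>The blocks form an indexed family \<open>A 1, \<dots>, A b\<close>, so repeated blocks are allowed. The values of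
  the replication number \<open>e\<close> and of \<open>b\<close> are not assumed; they follow, see \<open>bibd_counts\<close>.\<close>

definition bibd :: "nat \<Rightarrow> nat \<Rightarrow> nat \<Rightarrow> nat \<Rightarrow> (nat \<Rightarrow> nat set) \<Rightarrow> bool" where
  "bibd n r lam b A \<longleftrightarrow>
     1 \<le> lam \<and>
     (\<forall>i\<in>{1..b}. A i \<subseteq> {1..n} \<and> card (A i) = r) \<and>
     (\<exists>e. \<forall>x\<in>{1..n}. card {i\<in>{1..b}. x \<in> A i} = e) \<and>
     (\<forall>P. P \<subseteq> {1..n} \<and> card P = 2 \<longrightarrow> card {i\<in>{1..b}. P \<subseteq> A i} = lam)"

lemma bibd_counts:
  assumes "bibd n r lam b A" and x: "x \<in> {1..n}"
  defines "e \<equiv> card {i\<in>{1..b}. x \<in> A i}"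
  shows "e * (r - 1) = lam * (n - 1)"
    and "b * r = n * e"
    and "b * (r * (r - 1)) = lam * (n * (n - 1))"
proof -
  have A: "A i \<subseteq> {1..n}" "card (A i) = r" if "i \<in> {1..b}" for i
    using assms(1) that unfolding bibd_def by auto
  have fin: "finite (A i)" if "i \<in> {1..b}" for i
    using A(1)[OF that] finite_subset by blast
  have e: "card {i\<in>{1..b}. y \<in> A i} = e" if "y \<in> {1..n}" for y
    proof -
    obtain e' where "\<forall>z\<in>{1..n}. card {i\<in>{1..b}. z \<in> A i} = e'"
      using assms(1) unfolding bibd_def by blast
    then show ?thesis using that x by (simp add: e_def)
  qed
  have l: "card {i\<in>{1..b}. x \<in> A i \<and> y \<in> A i} = lam" if "y \<in> {1..n} - {x}" for y
  proof -
    have "card {x, y} = 2" "{x, y} \<subseteq> {1..n}" using that x by auto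
    then have "card {i\<in>{1..b}. {x, y} \<subseteq> A i} = lam"
      using assms(1) unfolding bibd_def by blast
    then show ?thesis by simp
  qed
  have "(\<Sum>y\<in>{1..n}-{x}. card {i\<in>{i\<in>{1..b}. x \<in> A i}. y \<in> A i}) = (r - 1) * card {i\<in>{1..b}. x \<in> A i}"
  proof (rule sum_multicount)
    show "\<forall>i\<in>{i\<in>{1..b}. x \<in> A i}. card {y\<in>{1..n}-{x}. y \<in> A i} = r - 1"
    proof
      fix i assume i: "i \<in> {i\<in>{1..b}. x \<in> A i}"
      then have "{y\<in>{1..n}-{x}. y \<in> A i} = A i - {x}" using A(1)[of i] by auto
      then show "card {y\<in>{1..n}-{x}. y \<in> A i} = r - 1" using i A(2)[of i] fin[of i] by simp
    qed
  qed auto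
  moreover have "(\<Sum>y\<in>{1..n}-{x}. card {i\<in>{i\<in>{1..b}. x \<in> A i}. y \<in> A i}) = lam * (n - 1)"
    using l x by simp
  ultimately show 1: "e * (r - 1) = lam * (n - 1)"
    unfolding e_def by (simp add: mult.commute)
  have "(\<Sum>y\<in>{1..n}. card {i\<in>{1..b}. y \<in> A i}) = r * card {1..b}"
  proof (rule sum_multicount)
    show "\<forall>i\<in>{1..b}. card {y\<in>{1..n}. y \<in> A i} = r"
    proof
      fix i assume i: "i \<in> {1..b}"
      then have "{y\<in>{1..n}. y \<in> A i} = A i" using A(1)[of i] by auto
      then show "card {y\<in>{1..n}. y \<in> A i} = r" using A(2)[OF i] by simp
    qed
  qed auto
  moreover have "(\<Sum>y\<in>{1..n}. card {i\<in>{1..b}. y \<in> A i}) = n * e"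
    using e by simp
  ultimately show 2: "b * r = n * e" by (simp add: mult.commute)
  have "b * (r * (r - 1)) = b * r * (r - 1)" by (rule mult.assoc [symmetric])
  also have "\<dots> = n * (e * (r - 1))" unfolding 2 by (rule mult.assoc)
  also have "\<dots> = lam * (n * (n - 1))" unfolding 1 by (rule mult.left_commute)
  finally show "b * (r * (r - 1)) = lam * (n * (n - 1))" .
qed

section \<open>Determination of data\<close>

text \<open>\<open>D\<close> is the set of all possible data and \<open>obs d y\<close> is what is read from node \<open>y\<close> when the data
  is \<open>d\<close>: the readings from the nodes in \<open>K\<close> determine \<open>x d\<close>, by one decoder for all data.\<close>

definition determines ::
  "'d set \<Rightarrow> nat set \<Rightarrow> ('d \<Rightarrow> nat \<Rightarrow> 'u) \<Rightarrow> ('d \<Rightarrow> 'v) \<Rightarrow> bool" where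
  "determines D K obs x \<longleftrightarrow> (\<exists>dec. \<forall>d\<in>D. x d = dec (restrict (obs d) K))"

section \<open>Systematic MSR codes\<close>

definition msr_data :: "nat \<Rightarrow> nat \<Rightarrow> (nat \<Rightarrow> 'f vec) set" where
  "msr_data a k = {1..k} \<rightarrow>\<^sub>E carrier_vec a"

definition msr_content ::
  "nat \<Rightarrow> nat \<Rightarrow> (nat \<Rightarrow> nat \<Rightarrow> 'f::field mat) \<Rightarrow> (nat \<Rightarrow> 'f vec) \<Rightarrow> nat \<Rightarrow> 'f vec" where
  "msr_content a k C f j =
     (if j \<le> k then f j else finsum_vec TYPE('f) a (\<lambda>i. C (j - k) i *\<^sub>v f i) {1..k})"

definition msr_code :: "nat \<Rightarrow> nat \<Rightarrow> nat \<Rightarrow> (nat \<Rightarrow> nat \<Rightarrow> 'f::field mat) \<Rightarrow> bool" where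
  "msr_code a k r C \<longleftrightarrow>
     r dvd a \<and>
     (\<forall>j\<in>{1..r}. \<forall>i\<in>{1..k}. C j i \<in> carrier_mat a a) \<and>
     (\<forall>K. K \<subseteq> {1..k+r} \<and> card K = k \<longrightarrow>
        determines (msr_data a k) K (msr_content a k C) (\<lambda>f. f)) \<and>
     (\<forall>i\<in>{1..k}. \<exists>S. S \<in> carrier_mat (a div r) a \<and>
        vec_space.rank (a div r) S = a div r \<and>
        determines (msr_data a k) ({1..k+r} - {i})
          (\<lambda>f j. S *\<^sub>v msr_content a k C f j) (\<lambda>f. f i))"

section \<open>Piggybacking\<close>

text \<open>Concatenation of the vectors \<open>v 1, \<dots>, v N\<close>, each of length \<open>m\<close>.\<close>

definition concat_vecs :: "nat \<Rightarrow> nat \<Rightarrow> (nat \<Rightarrow> 'f vec) \<Rightarrow> 'f vec" where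
  "concat_vecs N m v = vec (N * m) (\<lambda>s. v (s div m + 1) $ (s mod m))"

lemma concat_vecs_eq:
  assumes "\<And>i. i \<in> {1..N} \<Longrightarrow> v i \<in> carrier_vec m"
  shows "concat_vecs N m v = vec_of_list (concat (map (\<lambda>i. list_of_vec (v i)) [1..<N+1]))"
  using assms
proof (induction N)
  case 0
  then show ?case by (auto simp: concat_vecs_def)
next
  case (Suc N)
  have IH: "concat_vecs N m v = vec_of_list (concat (map (\<lambda>i. list_of_vec (v i)) [1..<N+1]))"
    using Suc.prems by (intro Suc.IH) simp
  have "concat_vecs (Suc N) m v = concat_vecs N m v @\<^sub>v v (Suc N)"
  proof (rule eq_vecI)
    show "dim_vec (concat_vecs (Suc N) m v) = dim_vec (concat_vecs N m v @\<^sub>v v (Suc N))"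
      using Suc.prems[of "Suc N"] by (auto simp: concat_vecs_def)
    fix s assume "s < dim_vec (concat_vecs N m v @\<^sub>v v (Suc N))"
    then have s: "s < N * m + m" using Suc.prems[of "Suc N"] by (auto simp: concat_vecs_def)
    have "s div m = N" "s mod m = s - N * m" if "\<not> s < N * m"
    proof -
      define t where "t = s - N * m"
      have t: "s = t + m * N" "t < m" using s that by (simp_all add: t_def mult.commute)
      show "s div m = N" unfolding t(1) using t(2) by (subst div_mult_self2) auto
      show "s mod m = s - N * m" unfolding t(1) using t(2) by simp
    qed
    then show "concat_vecs (Suc N) m v $ s = (concat_vecs N m v @\<^sub>v v (Suc N)) $ s"
      using s Suc.prems[of "Suc N"] by (auto simp: concat_vecs_def)
  qed
  also have "\<dots> = vec_of_list (concat (map (\<lambda>i. list_of_vec (v i)) [1..<Suc N+1]))"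
  proof -
    have "vec_of_list (xs @ list_of_vec w) = vec_of_list xs @\<^sub>v w" for xs and w :: "'a vec"
      by (rule eq_vecI) (auto simp: vec_of_list_index nth_append list_of_vec_index)
    then show ?thesis unfolding IH by simp
  qed
  finally show ?case .
qed

definition piggyback_terms :: "nat \<Rightarrow> (nat \<Rightarrow> nat \<Rightarrow> nat) \<Rightarrow> nat \<Rightarrow> (nat \<times> nat) set" where
  "piggyback_terms r p l = {(i, j). i \<in> {1..r} \<and> j \<in> {1..<r} \<and> p i j = l}"

definition piggyback_scheme :: "nat \<Rightarrow> (nat \<Rightarrow> nat \<Rightarrow> nat) \<Rightarrow> bool" where
  "piggyback_scheme r p \<longleftrightarrow>
     (\<forall>i\<in>{1..r}. p i \<in> {1..r} \<rightarrow> {1..r} \<and> inj_on (p i) {1..r} \<and> p i r = i) \<and>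
     (\<forall>l\<in>{1..r}. card (piggyback_terms r p l) = r - 1)"

text \<open>In the piggybacked code, \<open>F m i\<close> is the data vector \<open>i\<close> of instance \<open>m\<close> of the MSR code.\<close>

definition piggyback ::
  "nat \<Rightarrow> nat \<Rightarrow> nat \<Rightarrow> (nat \<Rightarrow> nat \<Rightarrow> 'f::field mat) \<Rightarrow> (nat \<Rightarrow> nat \<Rightarrow> nat) \<Rightarrow>
   (nat \<Rightarrow> nat \<Rightarrow> 'f vec) \<Rightarrow> nat \<Rightarrow> 'f vec" where
  "piggyback a k r C p F l =
     finsum_vec TYPE('f) a (\<lambda>(i, j). msr_content a k C (F j) (k + i)) (piggyback_terms r p l)"

definition piggyback_content ::
  "nat \<Rightarrow> nat \<Rightarrow> nat \<Rightarrow> (nat \<Rightarrow> nat \<Rightarrow> 'f::field mat) \<Rightarrow> (nat \<Rightarrow> nat \<Rightarrow> nat) \<Rightarrow>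
   (nat \<Rightarrow> nat \<Rightarrow> 'f vec) \<Rightarrow> nat \<Rightarrow> 'f vec" where
  "piggyback_content a k r C p F j =
     concat_vecs r a (\<lambda>m.
       if k < j \<and> m = r then msr_content a k C (F m) j + piggyback a k r C p F (j - k)
       else msr_content a k C (F m) j)"

section \<open>The code constructed from a block design\<close>

text \<open>\<open>\<sigma> i x\<close> is the node of instance \<open>i\<close> of the piggybacked code whose content is placed on node \<open>x\<close>.\<close>

definition placement ::
  "nat \<Rightarrow> nat \<Rightarrow> nat \<Rightarrow> (nat \<Rightarrow> nat set) \<Rightarrow> (nat \<Rightarrow> nat \<Rightarrow> nat) \<Rightarrow> bool" where
  "placement k r b A \<sigma> \<longleftrightarrow>
     (\<forall>i\<in>{1..b}. bij_betw (\<sigma> i) (A i) {k+1..k+r} \<and> bij_betw (\<sigma> i) ({1..k+r} - A i) {1..k})"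

definition design_data :: "nat \<Rightarrow> nat \<Rightarrow> nat \<Rightarrow> nat \<Rightarrow> (nat \<Rightarrow> nat \<Rightarrow> nat \<Rightarrow> 'f vec) set" where
  "design_data a k r b = {1..b} \<rightarrow>\<^sub>E ({1..r} \<rightarrow>\<^sub>E msr_data a k)"

definition design_content ::
  "nat \<Rightarrow> nat \<Rightarrow> nat \<Rightarrow> nat \<Rightarrow> (nat \<Rightarrow> nat \<Rightarrow> 'f::field mat) \<Rightarrow> (nat \<Rightarrow> nat \<Rightarrow> nat) \<Rightarrow>
   (nat \<Rightarrow> nat \<Rightarrow> nat) \<Rightarrow> (nat \<Rightarrow> nat \<Rightarrow> nat \<Rightarrow> 'f vec) \<Rightarrow> nat \<Rightarrow> 'f vec" where
  "design_content a k r b C p \<sigma> d x =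
     concat_vecs b (r * a) (\<lambda>i. piggyback_content a k r C p (d i) (\<sigma> i x))"

definition design_node_size :: "nat \<Rightarrow> nat \<Rightarrow> nat \<Rightarrow> nat" where
  "design_node_size a r b = b * (r * a)"

lemma design_content_carrier:
  "design_content a k r b C p \<sigma> d x \<in> carrier_vec (design_node_size a r b)"
  by (simp add: design_content_def design_node_size_def concat_vecs_def)

section \<open>Repair with balanced download\<close>

text \<open>Whichever node \<open>x\<close> fails, every surviving node \<open>y\<close> transmits a linear image \<open>M y\<close> of its content
  (a vector of length \<open>\<alpha>\<close>) with exactly \<open>\<beta>\<close> symbols, \<open>M\<close> depending only on \<open>x\<close> and not on the data.\<close>

definition balanced_download ::
  "'d set \<Rightarrow> nat \<Rightarrow> nat \<Rightarrow> ('d \<Rightarrow> nat \<Rightarrow> 'f::field vec) \<Rightarrow> nat \<Rightarrow> bool" where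
  "balanced_download D n \<alpha> cont \<beta> \<longleftrightarrow>
     (\<forall>x\<in>{1..n}. \<exists>M.
        (\<forall>y\<in>{1..n} - {x}. M y \<in> carrier_mat \<beta> \<alpha>) \<and>
        determines D ({1..n} - {x}) (\<lambda>d y. M y *\<^sub>v cont d y) (\<lambda>d. cont d x))"

end

theory Submission
  imports Defs
begin

text \<open>Let node \<open>x\<close> fail. For a block \<open>A i\<close> not containing \<open>x\<close>, a systematic node of instance \<open>i\<close> is
  lost, and every surviving node sends \<open>a\<close> symbols by the repair matrix of the MSR code. If \<open>x \<in> A i\<close>,
  a parity node is lost: each systematic node sends the \<open>a\<close> symbols of its last MSR instance, and each of
  the other parity nodes sends all of its \<open>r * a\<close> symbols. The expensive case occurs for
  \<open>y\<close> exactly when \<open>{x, y} \<subseteq> A i\<close>, hence for \<open>lam\<close> blocks whatever \<open>x\<close> and \<open>y\<close> are, so every \<open>y\<close>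
  sends \<open>b * a + lam * ((r - 1) * a)\<close> symbols. For recovery it suffices that equal
  downloads force equal contents.\<close>

section \<open>Decoding as separation of data\<close>

text \<open>If equal readings force equal values, a decoder can choose any datum compatible with the
  reading. Recovery thus becomes a comparison of two data, with no decoder to construct.\<close>

lemma determines_iff:
  "determines D K obs x \<longleftrightarrow>
     (\<forall>d\<in>D. \<forall>d'\<in>D. (\<forall>y\<in>K. obs d y = obs d' y) \<longrightarrow> x d = x d')"
proof
  assume "determines D K obs x"
  then obtain dec where dec: "\<And>d. d \<in> D \<Longrightarrow> x d = dec (restrict (obs d) K)"
    unfolding determines_def by blast
  show "\<forall>d\<in>D. \<forall>d'\<in>D. (\<forall>y\<in>K. obs d y = obs d' y) \<longrightarrow> x d = x d'"
  proof (intro ballI impI)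
    fix d d' assume d: "d \<in> D" "d' \<in> D" and eq: "\<forall>y\<in>K. obs d y = obs d' y"
    have "restrict (obs d) K = restrict (obs d') K"
      using eq by (auto simp: restrict_def)
    then show "x d = x d'" using dec d by metis
  qed
next
  assume inj: "\<forall>d\<in>D. \<forall>d'\<in>D. (\<forall>y\<in>K. obs d y = obs d' y) \<longrightarrow> x d = x d'"
  define dec where "dec q = x (SOME d'. d' \<in> D \<and> restrict (obs d') K = q)" for q
  have "x d = dec (restrict (obs d) K)" if d: "d \<in> D" for d
  proof -
    define d' where "d' = (SOME d'. d' \<in> D \<and> restrict (obs d') K = restrict (obs d) K)"
    have d': "d' \<in> D \<and> restrict (obs d') K = restrict (obs d) K"
      unfolding d'_def by (rule someI [where x = d]) (use d in simp)
    then have "\<forall>y\<in>K. obs d y = obs d' y" by (metis restrict_apply')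
    then have "x d = x d'" using inj d d' by blast
    then show ?thesis by (simp add: dec_def d'_def)
  qed
  then show "determines D K obs x" unfolding determines_def by blast
qed

lemma mult_mat_vec_eq_iff:
  assumes "B \<in> carrier_mat q m"
  shows "B *\<^sub>v c = B *\<^sub>v c' \<longleftrightarrow> (\<forall>w\<in>set (rows B). w \<bullet> c = w \<bullet> c')"
  using assms by (auto simp: rows_def vec_eq_iff)

lemma mult_mat_of_rows_vec_eq_iff:
  assumes "\<And>w. w \<in> set ws \<Longrightarrow> w \<in> carrier_vec m"
  shows "mat_of_rows m ws *\<^sub>v c = mat_of_rows m ws *\<^sub>v c' \<longleftrightarrow> (\<forall>w\<in>set ws. w \<bullet> c = w \<bullet> c')"
  using mult_mat_vec_eq_iff [OF mat_of_rows_carrier(1), of m ws c c'] assms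
  by (simp add: subset_iff)

section \<open>Sums of vectors\<close>

text \<open>\<open>S\<close> is linear, so knowing \<open>S\<close> on every summand fixes
  \<open>S\<close> on the sum. This yields \<open>S\<close> applied to a piggyback, which no node
  sends separately.\<close>

lemma mult_mat_vec_finsum_cong:
  fixes S :: "'f::field mat"
  assumes S: "S \<in> carrier_mat q a" and "finite T"
    and "\<And>t. t \<in> T \<Longrightarrow> u t \<in> carrier_vec a" "\<And>t. t \<in> T \<Longrightarrow> u' t \<in> carrier_vec a"
    and "\<And>t. t \<in> T \<Longrightarrow> S *\<^sub>v u t = S *\<^sub>v u' t"
  shows "S *\<^sub>v finsum_vec TYPE('f) a u T = S *\<^sub>v finsum_vec TYPE('f) a u' T"
  using assms(2-)
proof (induction T)
  case (insert t T)
  have "finsum_vec TYPE('f) a v (insert t T) = v t + finsum_vec TYPE('f) a v T"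
    "finsum_vec TYPE('f) a v T \<in> carrier_vec a"
    if "\<And>s. s \<in> insert t T \<Longrightarrow> v s \<in> carrier_vec a" for v
    using insert.hyps that by (auto intro!: finsum_vec_insert finsum_vec_closed)
  then show ?case
    using insert by (simp add: mult_add_distrib_mat_vec [OF S])
qed (simp add: finsum_vec_empty)

lemma finsum_vec_cong:
  assumes "finite T"
    and "\<And>t. t \<in> T \<Longrightarrow> u t \<in> carrier_vec a" "\<And>t. t \<in> T \<Longrightarrow> u' t \<in> carrier_vec a"
    and "\<And>t. t \<in> T \<Longrightarrow> u t = u' t"
  shows "finsum_vec TYPE('f::field) a u T = finsum_vec TYPE('f) a u' T"
  \<comment> \<open>The identity matrix as \<open>S\<close> turns the statement about images into
    one about the sums themselves.\<close>
  using mult_mat_vec_finsum_cong [OF one_carrier_mat, of T u a u'] assms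
  by (simp add: one_mult_mat_vec [OF finsum_vec_closed])

text \<open>Subtracting the known summands in each coordinate leaves the one at \<open>e\<close>;
  this solves a piggyback for its single unknown term.\<close>

lemma finsum_vec_cancel:
  assumes T: "finite T" "e \<in> T"
    and u: "\<And>t. t \<in> T \<Longrightarrow> u t \<in> carrier_vec a" "\<And>t. t \<in> T \<Longrightarrow> u' t \<in> carrier_vec a"
    and eq: "finsum_vec TYPE('f::field) a u T = finsum_vec TYPE('f) a u' T"
    and rest: "\<And>t. t \<in> T - {e} \<Longrightarrow> u t = u' t"
  shows "u e = u' e"
proof (rule eq_vecI)
  show "dim_vec (u e) = dim_vec (u' e)" using u T by fastforce
  fix s assume "s < dim_vec (u' e)"
  then have s: "s < a" using u(2) T by fastforce
  have "(\<Sum>t\<in>T. u t $ s) = finsum_vec TYPE('f) a u T $ s"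
    by (rule index_finsum_vec [symmetric]) (use T u s in auto)
  also have "\<dots> = (\<Sum>t\<in>T. u' t $ s)"
    unfolding eq by (rule index_finsum_vec) (use T u s in auto)
  finally have "u e $ s + (\<Sum>t\<in>T-{e}. u t $ s) = u' e $ s + (\<Sum>t\<in>T-{e}. u' t $ s)"
    using T by (simp add: sum.remove)
  moreover have "(\<Sum>t\<in>T-{e}. u t $ s) = (\<Sum>t\<in>T-{e}. u' t $ s)"
    using rest by (intro sum.cong) auto
  ultimately show "u e $ s = u' e $ s" by simp
qed

section \<open>Concatenated vectors\<close>

lemma div_add_one_mem:
  assumes "s < N * (m::nat)"
  shows "s div m + 1 \<in> {1..N}" "s mod m < m"
  using assms by (cases "m = 0"; simp add: less_mult_imp_div_less Suc_le_eq)+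

lemma concat_vecs_cong:
  assumes "\<And>i. i \<in> {1..N} \<Longrightarrow> v i = v' i"
  shows "concat_vecs N m v = concat_vecs N m v'"
  using assms div_add_one_mem by (auto simp: concat_vecs_def)

text \<open>Viewed through the scalar product, this extends a functional \<open>w\<close> on slot
  \<open>i\<close> to the whole concatenation.\<close>

definition embed :: "nat \<Rightarrow> nat \<Rightarrow> nat \<Rightarrow> 'f::zero vec \<Rightarrow> 'f vec" where
  "embed N m i w = concat_vecs N m (\<lambda>j. if j = i then w else 0\<^sub>v m)"

lemma concat_vecs_carrier: "concat_vecs N m v \<in> carrier_vec (N * m)"
  by (simp add: concat_vecs_def)

lemma embed_carrier: "embed N m i w \<in> carrier_vec (N * m)"
  by (simp add: embed_def concat_vecs_carrier)

text \<open>The \<open>N * m\<close> coordinates split into \<open>N\<close> consecutive groups of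
  length \<open>m\<close>, and the embedded vector vanishes on all groups but one.\<close>

lemma scalar_prod_embed:
  fixes w :: "'f::semiring_0 vec"
  assumes i: "i \<in> {1..N}" and v: "v i \<in> carrier_vec m"
  shows "embed N m i w \<bullet> concat_vecs N m v = w \<bullet> v i"
proof -
  \<comment> \<open>Slots are counted from 1 and groups of coordinates from 0; \<open>i'\<close> is
    the group of slot \<open>i\<close>.\<close>
  obtain i' where i': "i = Suc i'" "i' < N" using i by (cases i) auto
  define g where "g s = embed N m i w $ s * concat_vecs N m v $ s" for s
  have g: "g (t + j * m) = (if j = i' then w $ t * v i $ t else 0)" if j: "j < N" and t: "t < m" for j t
  proof -
    have "t + j * m < Suc j * m" using t by simp
    also have "\<dots> \<le> N * m" using j by (intro mult_le_mono1) simp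
    finally have "t + j * m < N * m" .
    then show ?thesis using t by (auto simp: g_def embed_def concat_vecs_def i')
  qed
  have "embed N m i w \<bullet> concat_vecs N m v = sum g {..<N * m}"
    by (simp add: scalar_prod_def g_def concat_vecs_def lessThan_atLeast0)
  also have "\<dots> = (\<Sum>j<N. sum g {j * m..<j * m + m})"
    by (rule sum.nat_group [symmetric])
  also have "\<dots> = (\<Sum>j<N. \<Sum>t<m. g (t + j * m))"
    using sum.shift_bounds_nat_ivl [of g 0 "_ * m" m] by (simp add: lessThan_atLeast0 add.commute)
  also have "\<dots> = (\<Sum>j<N. if j = i' then \<Sum>t<m. w $ t * v i $ t else 0)"
    by (intro sum.cong refl) (auto simp: g)
  also have "\<dots> = (\<Sum>t<m. w $ t * v i $ t)"
    using i' by (subst sum.delta) auto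
  also have "\<dots> = w \<bullet> v i"
    using v by (simp add: scalar_prod_def lessThan_atLeast0)
  finally show ?thesis .
qed

text \<open>These are the rows of a block diagonal matrix whose diagonal block \<open>i\<close> has
  the rows \<open>R i\<close>. Lists allow a different number of rows for each slot.\<close>

definition embedded_rows :: "nat \<Rightarrow> nat \<Rightarrow> (nat \<Rightarrow> 'f::zero vec list) \<Rightarrow> 'f vec list" where
  "embedded_rows b m R = concat (map (\<lambda>i. map (embed b m i) (R i)) [1..<b+1])"

lemma embed_mem_embedded_rows:
  "i \<in> {1..b} \<Longrightarrow> w \<in> set (R i) \<Longrightarrow> embed b m i w \<in> set (embedded_rows b m R)"
  by (force simp: embedded_rows_def simp del: upt_Suc)

lemma embedded_rows_carrier: "w \<in> set (embedded_rows b m R) \<Longrightarrow> w \<in> carrier_vec (b * m)"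
  by (auto simp: embedded_rows_def embed_carrier)

lemma length_embedded_rows: "length (embedded_rows b m R) = (\<Sum>i\<in>{1..b}. length (R i))"
  by (simp add: embedded_rows_def length_concat comp_def sum_list_distinct_conv_sum_set
      atLeastLessThanSuc_atLeastAtMost del: upt_Suc)

section \<open>Repair of one piggybacked instance\<close>

text \<open>One slot of a node before concatenation, named so that the repair arguments can work
  slot by slot.\<close>

definition piggyback_part ::
  "nat \<Rightarrow> nat \<Rightarrow> nat \<Rightarrow> (nat \<Rightarrow> nat \<Rightarrow> 'f::field mat) \<Rightarrow> (nat \<Rightarrow> nat \<Rightarrow> nat) \<Rightarrow>
   (nat \<Rightarrow> nat \<Rightarrow> 'f vec) \<Rightarrow> nat \<Rightarrow> nat \<Rightarrow> 'f vec" where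
  "piggyback_part a k r C p F j m =
     (if k < j \<and> m = r then msr_content a k C (F m) j + piggyback a k r C p F (j - k)
      else msr_content a k C (F m) j)"

lemma piggyback_content_eq:
  "piggyback_content a k r C p F j = concat_vecs r a (piggyback_part a k r C p F j)"
  by (simp add: piggyback_content_def piggyback_part_def [abs_def])

lemma msr_content_carrier:
  assumes C: "\<forall>j\<in>{1..r}. \<forall>i\<in>{1..k}. C j i \<in> carrier_mat a a"
    and "f \<in> msr_data a k" "j \<in> {1..k+r}"
  shows "msr_content a k C f j \<in> carrier_vec a"
proof -
  have "C (j - k) i *\<^sub>v f i \<in> carrier_vec a" if "\<not> j \<le> k" "i \<in> {1..k}" for i
  proof -
    have "j - k \<in> {1..r}" using that(1) assms(3) by auto
    then show ?thesis
      using that(2) assms(1,2) by (intro mult_mat_vec_carrier [of _ a a]) (auto simp: msr_data_def)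
  qed
  then show ?thesis
    using assms by (auto simp: msr_content_def msr_data_def intro!: finsum_vec_closed)
qed

lemma finite_piggyback_terms: "finite (piggyback_terms r p l)"
  by (rule finite_subset [of _ "{1..r} \<times> {1..<r}"]) (auto simp: piggyback_terms_def)

context
  fixes a k r :: nat and C :: "nat \<Rightarrow> nat \<Rightarrow> 'f::field mat" and p :: "nat \<Rightarrow> nat \<Rightarrow> nat"
    and F F' :: "nat \<Rightarrow> nat \<Rightarrow> 'f vec"
  assumes C: "\<forall>j\<in>{1..r}. \<forall>i\<in>{1..k}. C j i \<in> carrier_mat a a"
    and F: "\<forall>m\<in>{1..r}. F m \<in> msr_data a k"
    and F': "\<forall>m\<in>{1..r}. F' m \<in> msr_data a k"
begin

lemma contents_carrier:
  assumes "m \<in> {1..r}" "j \<in> {1..k+r}"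
  shows "msr_content a k C (F m) j \<in> carrier_vec a" "msr_content a k C (F' m) j \<in> carrier_vec a"
  using msr_content_carrier [OF C] F F' assms by blast+

lemma terms_carrier:
  assumes "t \<in> piggyback_terms r p l"
  shows "(\<lambda>(i, j). msr_content a k C (F j) (k + i)) t \<in> carrier_vec a"
    "(\<lambda>(i, j). msr_content a k C (F' j) (k + i)) t \<in> carrier_vec a"
  using assms contents_carrier by (auto simp: piggyback_terms_def)

lemma piggyback_carrier:
  "piggyback a k r C p F l \<in> carrier_vec a" "piggyback a k r C p F' l \<in> carrier_vec a"
  unfolding piggyback_def using terms_carrier by (auto intro!: finsum_vec_closed)

lemma piggyback_part_carrier:
  assumes "m \<in> {1..r}" "j \<in> {1..k+r}"
  shows "piggyback_part a k r C p F j m \<in> carrier_vec a"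
    "piggyback_part a k r C p F' j m \<in> carrier_vec a"
  using contents_carrier [OF assms] piggyback_carrier by (auto simp: piggyback_part_def)

text \<open>The first \<open>r - 1\<close> instances carry no piggybacks and are repaired directly; the same downloads
  give \<open>S\<close> applied to every piggyback, which is then removed from the last instance.\<close>

lemma systematic_repair:
  assumes j: "j \<in> {1..k}" and S: "S \<in> carrier_mat q a"
    and det: "determines (msr_data a k) ({1..k+r} - {j})
          (\<lambda>f y. S *\<^sub>v msr_content a k C f y) (\<lambda>f. f j)"
    and eq: "\<And>y m. y \<in> {1..k+r} - {j} \<Longrightarrow> m \<in> {1..r} \<Longrightarrow>
      S *\<^sub>v piggyback_part a k r C p F y m = S *\<^sub>v piggyback_part a k r C p F' y m"
    and m: "m \<in> {1..r}"
  shows "F m j = F' m j"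
proof -
  have content: "S *\<^sub>v msr_content a k C (F m) y = S *\<^sub>v msr_content a k C (F' m) y"
    if "y \<in> {1..k+r} - {j}" "m \<in> {1..r}" "m \<noteq> r" for y m
    using eq [OF that(1,2)] that(3) by (simp add: piggyback_part_def)
  have "S *\<^sub>v msr_content a k C (F m) y = S *\<^sub>v msr_content a k C (F' m) y"
    if y: "y \<in> {1..k+r} - {j}" for y
  proof (cases "k < y \<and> m = r")
    case False
    then show ?thesis using eq [OF y m] by (simp add: piggyback_part_def split: if_splits)
  next
    case True
    have P: "S *\<^sub>v piggyback a k r C p F (y - k) = S *\<^sub>v piggyback a k r C p F' (y - k)"
      unfolding piggyback_def
    \<comment> \<open>Every summand comes from an instance before \<open>r\<close> and from a parity
      node. The lost node is systematic, so all parity nodes survive and \<open>content\<close>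
      applies.\<close>
    proof (rule mult_mat_vec_finsum_cong [OF S finite_piggyback_terms terms_carrier])
      fix t assume "t \<in> piggyback_terms r p (y - k)"
      then show "S *\<^sub>v (case t of (i, j) \<Rightarrow> msr_content a k C (F j) (k + i)) =
          S *\<^sub>v (case t of (i, j) \<Rightarrow> msr_content a k C (F' j) (k + i))"
        using j by (auto simp: piggyback_terms_def intro!: content)
    qed
    have "S *\<^sub>v msr_content a k C (F m) y + S *\<^sub>v piggyback a k r C p F (y - k) =
        S *\<^sub>v msr_content a k C (F' m) y + S *\<^sub>v piggyback a k r C p F' (y - k)"
      using eq [OF y m] True y contents_carrier [OF m, of y] piggyback_carrier [of "y - k"]
      by (simp add: piggyback_part_def mult_add_distrib_mat_vec [OF S])
    then show ?thesis
      using S unfolding P by (auto simp: vec_eq_iff)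
  qed
  then show ?thesis using det F F' m unfolding determines_iff by blast
qed

text \<open>The systematic nodes supply the whole of instance \<open>r\<close>, so the piggybacks on the surviving parity
  nodes can be read off. The symbols of node \<open>l\<close> occur in these, at most once in each because
  \<open>p l\<close> is injective, and never on node \<open>l\<close> itself because \<open>p l r = l\<close>.\<close>

lemma parity_repair:
  assumes p: "piggyback_scheme r p" and l: "l \<in> {1..r}" and r: "1 \<le> r"
    and sys: "\<And>i. i \<in> {1..k} \<Longrightarrow> F r i = F' r i"
    and par: "\<And>l' m. l' \<in> {1..r} - {l} \<Longrightarrow> m \<in> {1..r} \<Longrightarrow>
      piggyback_part a k r C p F (k + l') m = piggyback_part a k r C p F' (k + l') m"
    and m: "m \<in> {1..r}"
  shows "piggyback_part a k r C p F (k + l) m = piggyback_part a k r C p F' (k + l) m"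
proof -
  \<comment> \<open>Both sides are extensional on \<open>{1..k}\<close>, so agreement there makes
    them equal functions, and the parity contents of instance \<open>r\<close> agree too.\<close>
  have "F r = F' r"
    using sys F F' r unfolding msr_data_def by (intro PiE_ext [of _ \<open>{1..k}\<close> \<open>\<lambda>_. carrier_vec a\<close>]) auto
  then have last: "msr_content a k C (F r) y = msr_content a k C (F' r) y" for y
    by simp
  have other: "msr_content a k C (F m) (k + l') = msr_content a k C (F' m) (k + l')"
    if "l' \<in> {1..r} - {l}" "m \<in> {1..r}" "m \<noteq> r" for l' m
    using par [OF that(1,2)] that(3) by (simp add: piggyback_part_def)
  have P: "piggyback a k r C p F l' = piggyback a k r C p F' l'" if l': "l' \<in> {1..r} - {l}" for l'
  proof -
    have "msr_content a k C (F' r) (k + l') + piggyback a k r C p F l' =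
        msr_content a k C (F' r) (k + l') + piggyback a k r C p F' l'"
      using par [OF l', of r] l' r last by (simp add: piggyback_part_def)
    then show ?thesis
      using contents_carrier(2) [of r "k + l'"] l' r piggyback_carrier [of l']
      by (auto simp: vec_eq_iff)
  qed
  have self: "msr_content a k C (F j) (k + l) = msr_content a k C (F' j) (k + l)"
    if j: "j \<in> {1..<r}" for j
  proof -
    have pl: "p l \<in> {1..r} \<rightarrow> {1..r}" "inj_on (p l) {1..r}" "p l r = l"
      using p l unfolding piggyback_scheme_def by blast+
    have jr: "j \<in> {1..r}" "r \<in> {1..r}" "j \<noteq> r" using j by auto
    have "p l j \<noteq> l" using inj_onD [OF pl(2), of j r] pl(3) jr by auto
    then have l': "p l j \<in> {1..r} - {l}" using pl(1) jr by auto
    have e: "(l, j) \<in> piggyback_terms r p (p l j)"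
      using l j by (simp add: piggyback_terms_def)
    have "(\<lambda>(i, j). msr_content a k C (F j) (k + i)) (l, j) =
        (\<lambda>(i, j). msr_content a k C (F' j) (k + i)) (l, j)"
    proof (rule finsum_vec_cancel [OF finite_piggyback_terms e terms_carrier])
      fix t assume t: "t \<in> piggyback_terms r p (p l j) - {(l, j)}"
      obtain i m where im: "t = (i, m)" by (cases t)
      have *: "i \<in> {1..r}" "m \<in> {1..<r}" "p i m = p l j" "(i, m) \<noteq> (l, j)"
        using t by (auto simp: im piggyback_terms_def)
      have "i \<noteq> l" using inj_onD [OF pl(2), of m j] * jr by auto
      then show "(case t of (i, j) \<Rightarrow> msr_content a k C (F j) (k + i)) =
          (case t of (i, j) \<Rightarrow> msr_content a k C (F' j) (k + i))"
        using * by (auto simp: im intro!: other)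
    qed (use P [OF l'] in \<open>auto simp: piggyback_def\<close>)
    then show ?thesis by simp
  qed
  have all: "msr_content a k C (F m) (k + i) = msr_content a k C (F' m) (k + i)"
    if "i \<in> {1..r}" "m \<in> {1..r}" for i m
    using last self [of m] other [of i m] that by (cases "m = r"; cases "i = l") auto
  \<comment> \<open>All parity contents are known by now, so the piggyback stored on the lost node
    can be recomputed.\<close>
  have "piggyback a k r C p F l = piggyback a k r C p F' l"
    unfolding piggyback_def
    by (rule finsum_vec_cong [OF finite_piggyback_terms terms_carrier])
       (auto simp: piggyback_terms_def intro!: all)
  then show ?thesis using all [OF l m] by (cases "m = r") (auto simp: piggyback_part_def)
qed

end

section \<open>Downloads\<close>

definition stripe_rows :: "nat \<Rightarrow> nat \<Rightarrow> 'f::field mat \<Rightarrow> 'f vec list" where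
  "stripe_rows a r S = embedded_rows r a (\<lambda>_. rows S)"

text \<open>\<open>xpar\<close> and \<open>ypar\<close> tell whether the lost node and the helper
  are parity nodes of the instance. Rows of an identity matrix read single coordinates, so the last
  two cases send the whole content and the last slot.\<close>

definition download_rows ::
  "nat \<Rightarrow> nat \<Rightarrow> 'f::field mat \<Rightarrow> bool \<Rightarrow> bool \<Rightarrow> 'f vec list" where
  "download_rows a r S xpar ypar =
     (if \<not> xpar then stripe_rows a r S
      else if ypar then rows (1\<^sub>m (r * a))
      else map (embed r a r) (rows (1\<^sub>m a)))"

lemma download_rows_carrier:
  assumes "w \<in> set (download_rows a r S xpar ypar)"
  shows "w \<in> carrier_vec (r * a)"
  using assms by (auto simp: download_rows_def stripe_rows_def embed_carrier
      dest: embedded_rows_carrier set_rows_carrier [OF one_carrier_mat] split: if_splits)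

text \<open>A striped download has \<open>r\<close> copies of \<open>a div r\<close> rows, which
  make \<open>a\<close> rows because \<open>r\<close> divides \<open>a\<close>.\<close>

lemma length_download_rows:
  assumes "S \<in> carrier_mat (a div r) a" "r dvd a"
  shows "length (download_rows a r S xpar ypar) = (if xpar \<and> ypar then r * a else a)"
  using assms by (auto simp: download_rows_def stripe_rows_def length_embedded_rows)

lemma stripe_rows_eqD:
  assumes S: "S \<in> carrier_mat q a" and m: "m \<in> {1..r}"
    and v: "v m \<in> carrier_vec a" "v' m \<in> carrier_vec a"
    and eq: "\<And>w. w \<in> set (stripe_rows a r S) \<Longrightarrow> w \<bullet> concat_vecs r a v = w \<bullet> concat_vecs r a v'"
  shows "S *\<^sub>v v m = S *\<^sub>v v' m"
  unfolding mult_mat_vec_eq_iff [OF S]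
proof
  fix w assume "w \<in> set (rows S)"
  then have "embed r a m w \<in> set (stripe_rows a r S)"
    using m by (simp add: stripe_rows_def embed_mem_embedded_rows)
  from eq [OF this] show "w \<bullet> v m = w \<bullet> v' m"
    using m v by (simp add: scalar_prod_embed)
qed

lemma concat_vecs_nth_eqD:
  fixes v v' :: "nat \<Rightarrow> 'f::field vec"
  assumes "concat_vecs N a v = concat_vecs N a v'" and m: "m \<in> {1..N}"
    and v: "v m \<in> carrier_vec a" "v' m \<in> carrier_vec a"
  shows "v m = v' m"
proof -
  \<comment> \<open>Striping the identity matrix reads every coordinate of every slot.\<close>
  have "1\<^sub>m a *\<^sub>v v m = 1\<^sub>m a *\<^sub>v v' m"
    by (rule stripe_rows_eqD [where v = v and v' = v', OF one_carrier_mat m v]) (use assms in simp)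
  then show ?thesis using v by simp
qed

text \<open>Downloads are unpacked into the hypotheses of \<open>systematic_repair\<close> or
  \<open>parity_repair\<close>. \<open>det\<close> is conditional because the MSR code provides
  repair matrices for systematic nodes only.\<close>

lemma piggyback_download:
  fixes C :: "nat \<Rightarrow> nat \<Rightarrow> 'f::field mat"
  assumes msr: "msr_code a k r C" and p: "piggyback_scheme r p" and r: "1 \<le> r"
    and F: "F \<in> {1..r} \<rightarrow>\<^sub>E msr_data a k" and F': "F' \<in> {1..r} \<rightarrow>\<^sub>E msr_data a k"
    and j: "j \<in> {1..k+r}" and S: "S \<in> carrier_mat q a"
    and det: "j \<le> k \<Longrightarrow> determines (msr_data a k) ({1..k+r} - {j})
          (\<lambda>f y. S *\<^sub>v msr_content a k C f y) (\<lambda>f. f j)"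
    and eq: "\<And>y w. y \<in> {1..k+r} - {j} \<Longrightarrow> w \<in> set (download_rows a r S (k < j) (k < y)) \<Longrightarrow>
      w \<bullet> piggyback_content a k r C p F y = w \<bullet> piggyback_content a k r C p F' y"
  shows "piggyback_content a k r C p F j = piggyback_content a k r C p F' j"
proof -
  have C: "\<forall>j\<in>{1..r}. \<forall>i\<in>{1..k}. C j i \<in> carrier_mat a a"
    using msr unfolding msr_code_def by blast
  have F: "\<forall>m\<in>{1..r}. F m \<in> msr_data a k" using F by auto
  have F': "\<forall>m\<in>{1..r}. F' m \<in> msr_data a k" using F' by auto
  note part = piggyback_part_carrier [OF C F F', where p = p]
  have "piggyback_part a k r C p F j m = piggyback_part a k r C p F' j m" if m: "m \<in> {1..r}" for m
  proof (cases "j \<le> k")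
    case True
    have "S *\<^sub>v piggyback_part a k r C p F y m = S *\<^sub>v piggyback_part a k r C p F' y m"
      if y: "y \<in> {1..k+r} - {j}" and m: "m \<in> {1..r}" for y m
      using eq [OF y] True part [OF m, of y] y
      by (intro stripe_rows_eqD [OF S m]) (auto simp: download_rows_def piggyback_content_eq)
    then have "F m j = F' m j"
      using True j m by (intro systematic_repair [OF C F F' _ S det, where p = p]) auto
    then show ?thesis using True by (simp add: piggyback_part_def msr_content_def)
  next
    case False
    define l where "l = j - k"
    have l: "l \<in> {1..r}" "j = k + l" using j False by (auto simp: l_def)
    have sys: "F r i = F' r i" if i: "i \<in> {1..k}" for i
    proof -
      have ri: "r \<in> {1..r}" "i \<in> {1..k+r}" using r i by auto
      \<comment> \<open>A systematic helper sends its last slot, which carries no piggyback and is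
        the data vector \<open>F r i\<close> itself.\<close>
      have "1\<^sub>m a *\<^sub>v piggyback_part a k r C p F i r = 1\<^sub>m a *\<^sub>v piggyback_part a k r C p F' i r"
        unfolding mult_mat_vec_eq_iff [OF one_carrier_mat]
      proof
        fix w :: "'f vec" assume "w \<in> set (rows (1\<^sub>m a))"
        then have "embed r a r w \<bullet> piggyback_content a k r C p F i =
            embed r a r w \<bullet> piggyback_content a k r C p F' i"
          using i False by (intro eq) (auto simp: download_rows_def)
        then show "w \<bullet> piggyback_part a k r C p F i r = w \<bullet> piggyback_part a k r C p F' i r"
          using part [OF ri] r by (simp add: piggyback_content_eq scalar_prod_embed)
      qed
      then show ?thesis
        using part [OF ri] i by (simp add: piggyback_part_def msr_content_def)
    qed
    have par: "piggyback_part a k r C p F (k + l') m = piggyback_part a k r C p F' (k + l') m"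
      if l': "l' \<in> {1..r} - {l}" and m: "m \<in> {1..r}" for l' m
    proof -
      have y: "k + l' \<in> {1..k+r} - {j}" using l' l by auto
      have "1\<^sub>m (r * a) *\<^sub>v piggyback_content a k r C p F (k + l') =
          1\<^sub>m (r * a) *\<^sub>v piggyback_content a k r C p F' (k + l')"
        unfolding mult_mat_vec_eq_iff [OF one_carrier_mat]
        using eq [OF y] False l' by (auto simp: download_rows_def)
      then show ?thesis
        using part [OF m, of "k + l'"] y
        by (intro concat_vecs_nth_eqD [OF _ m])
          (auto simp: piggyback_content_eq one_mult_mat_vec [OF concat_vecs_carrier])
    qed
    show ?thesis
      unfolding l(2) by (rule parity_repair [OF C F F' p l(1) r sys par m])
  qed
  then show ?thesis
    unfolding piggyback_content_eq by (intro concat_vecs_cong) simp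
qed

section \<open>Placement on the blocks and counting of symbols\<close>

lemma placement_mem_iff:
  assumes "placement k r b A \<sigma>" "i \<in> {1..b}" "x \<in> {1..k+r}"
  shows "k < \<sigma> i x \<longleftrightarrow> x \<in> A i" and "\<sigma> i x \<in> {1..k+r}"
proof -
  have "bij_betw (\<sigma> i) (A i) {k+1..k+r}" "bij_betw (\<sigma> i) ({1..k+r} - A i) {1..k}"
    using assms unfolding placement_def by blast+
  then have "x \<in> A i \<Longrightarrow> \<sigma> i x \<in> {k+1..k+r}" "x \<notin> A i \<Longrightarrow> \<sigma> i x \<in> {1..k}"
    using assms(3) by (auto dest!: bij_betwE)
  then show "k < \<sigma> i x \<longleftrightarrow> x \<in> A i" and "\<sigma> i x \<in> {1..k+r}" by force+
qed

text \<open>The two bijections together cover all nodes of the instance, so each helper needed there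
  sits on a surviving node of the design code.\<close>

lemma placement_surj:
  assumes "placement k r b A \<sigma>" "i \<in> {1..b}" "A i \<subseteq> {1..k+r}"
    and z: "z \<in> {1..k+r} - {\<sigma> i x}"
  obtains y where "y \<in> {1..k+r} - {x}" "\<sigma> i y = z"
proof -
  have "bij_betw (\<sigma> i) (A i) {k+1..k+r}" "bij_betw (\<sigma> i) ({1..k+r} - A i) {1..k}"
    using assms unfolding placement_def by blast+
  then have "\<sigma> i ` A i = {k+1..k+r}" "\<sigma> i ` ({1..k+r} - A i) = {1..k}"
    by (auto simp: bij_betw_def)
  moreover have "z \<in> {k+1..k+r} \<or> z \<in> {1..k}" using z by auto
  ultimately have "z \<in> \<sigma> i ` {1..k+r}" using assms(3) by blast
  then show ?thesis using that z by blast
qed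

text \<open>Each block costs \<open>a\<close>, plus \<open>(r - 1) * a\<close> if it contains the
  pair \<open>{x, y}\<close>. The design puts every pair in \<open>lam\<close> blocks, which makes
  the total independent of \<open>x\<close> and \<open>y\<close>.\<close>

lemma bibd_download_size:
  assumes bibd: "bibd n r lam b A" and r: "1 \<le> r" and x: "x \<in> {1..n}" "y \<in> {1..n}" "x \<noteq> y"
  shows "(\<Sum>i\<in>{1..b}. if x \<in> A i \<and> y \<in> A i then r * a else a) = b * a + lam * ((r - 1) * a)"
proof -
  have "card {x, y} = 2" "{x, y} \<subseteq> {1..n}" using x by auto
  then have "card {i\<in>{1..b}. {x, y} \<subseteq> A i} = lam"
    using bibd unfolding bibd_def by blast
  then have lam: "card {i\<in>{1..b}. x \<in> A i \<and> y \<in> A i} = lam" by simp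
  have ra: "r * a = a + (r - 1) * a" using r by (cases r) auto
  have "(\<Sum>i\<in>{1..b}. if x \<in> A i \<and> y \<in> A i then r * a else a) =
      (\<Sum>i\<in>{1..b}. a + (if x \<in> A i \<and> y \<in> A i then (r - 1) * a else 0))"
    using ra by (intro sum.cong) auto
  also have "\<dots> = b * a + (\<Sum>i\<in>{i\<in>{1..b}. x \<in> A i \<and> y \<in> A i}. (r - 1) * a)"
    by (subst sum.inter_filter) (simp_all add: sum.distrib)
  finally show ?thesis using lam by simp
qed

text \<open>The \<open>b\<close> instances are independent and are repaired side by side, each
  helper using a block diagonal matrix with one block per instance.\<close>

lemma design_balanced_download:
  fixes C :: "nat \<Rightarrow> nat \<Rightarrow> 'f::field mat"
  assumes r: "1 \<le> r" and n: "n = k + r" and bibd: "bibd n r lam b A"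
    and msr: "msr_code a k r C" and p: "piggyback_scheme r p" and place: "placement k r b A \<sigma>"
  shows "balanced_download (design_data a k r b) n (design_node_size a r b)
           (design_content a k r b C p \<sigma>) (b * a + lam * ((r - 1) * a))"
  unfolding balanced_download_def
proof
  fix x assume x: "x \<in> {1..n}"
  have "r dvd a" using msr by (simp add: msr_code_def)
  \<comment> \<open>For a parity index \<open>j\<close> the zero matrix serves as a default, so that
    \<open>S j\<close> has the right size for every \<open>j\<close>.\<close>
  have "\<exists>S. S \<in> carrier_mat (a div r) a \<and> (j \<le> k \<longrightarrow> determines (msr_data a k) ({1..k+r} - {j})
          (\<lambda>f y. S *\<^sub>v msr_content a k C f y) (\<lambda>f. f j))" if "j \<in> {1..k+r}" for j
    using msr that zero_carrier_mat [of "a div r" a] unfolding msr_code_def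
    by (metis atLeastAtMost_iff)
  then obtain S where S: "\<And>j. j \<in> {1..k+r} \<Longrightarrow> S j \<in> carrier_mat (a div r) a"
    and det: "\<And>j. j \<in> {1..k+r} \<Longrightarrow> j \<le> k \<Longrightarrow> determines (msr_data a k) ({1..k+r} - {j})
          (\<lambda>f y. S j *\<^sub>v msr_content a k C f y) (\<lambda>f. f j)"
    by metis
  define R where "R y i = download_rows a r (S (\<sigma> i x)) (k < \<sigma> i x) (k < \<sigma> i y)" for y i
  define M where "M y = mat_of_rows (b * (r * a)) (embedded_rows b (r * a) (R y))" for y
  have "M y \<in> carrier_mat (b * a + lam * ((r - 1) * a)) (design_node_size a r b)"
    if y: "y \<in> {1..n} - {x}" for y
  proof -
    \<comment> \<open>A node is parity in instance \<open>i\<close> exactly when it lies in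
      \<open>A i\<close>, so the costly case is that of a block containing both \<open>x\<close> and
      \<open>y\<close>.\<close>
    have "length (R y i) = (if x \<in> A i \<and> y \<in> A i then r * a else a)" if i: "i \<in> {1..b}" for i
      using placement_mem_iff [OF place i, of x] placement_mem_iff [OF place i, of y] x y n
      by (simp add: R_def length_download_rows [OF S \<open>r dvd a\<close>])
    then have "length (embedded_rows b (r * a) (R y)) = b * a + lam * ((r - 1) * a)"
      using bibd_download_size [OF bibd r x, of y a] y by (simp add: length_embedded_rows)
    then show ?thesis
      using mat_of_rows_carrier(1) [of "b * (r * a)" "embedded_rows b (r * a) (R y)"]
      by (simp add: M_def design_node_size_def)
  qed
  moreover have "determines (design_data a k r b) ({1..n} - {x})
      (\<lambda>d y. M y *\<^sub>v design_content a k r b C p \<sigma> d y) (\<lambda>d. design_content a k r b C p \<sigma> d x)"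
    unfolding determines_iff
  proof (intro ballI impI)
    fix d d'
    assume d: "d \<in> design_data a k r b" "d' \<in> design_data a k r b"
      and eq: "\<forall>y\<in>{1..n} - {x}. M y *\<^sub>v design_content a k r b C p \<sigma> d y =
        M y *\<^sub>v design_content a k r b C p \<sigma> d' y"
    show "design_content a k r b C p \<sigma> d x = design_content a k r b C p \<sigma> d' x"
      unfolding design_content_def
    proof (rule concat_vecs_cong)
      fix i assume i: "i \<in> {1..b}"
      have xi: "\<sigma> i x \<in> {1..k+r}" using placement_mem_iff(2) [OF place i] x n by simp
      have Ai: "A i \<subseteq> {1..k+r}" using bibd i n unfolding bibd_def by blast
      have di: "d i \<in> {1..r} \<rightarrow>\<^sub>E msr_data a k" "d' i \<in> {1..r} \<rightarrow>\<^sub>E msr_data a k"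
        using d i unfolding design_data_def by blast+
      show "piggyback_content a k r C p (d i) (\<sigma> i x) = piggyback_content a k r C p (d' i) (\<sigma> i x)"
      proof (rule piggyback_download [OF msr p r di xi S [OF xi] det [OF xi]])
        fix z w
        assume z: "z \<in> {1..k+r} - {\<sigma> i x}"
          and w: "w \<in> set (download_rows a r (S (\<sigma> i x)) (k < \<sigma> i x) (k < z))"
        \<comment> \<open>The repair of an instance names its helper by the instance node
          \<open>z\<close>, whereas downloads are indexed by nodes of the design code.\<close>
        obtain y where y: "y \<in> {1..k+r} - {x}" "\<sigma> i y = z"
          using placement_surj [OF place i Ai z] .
        have "embed b (r * a) i w \<in> set (embedded_rows b (r * a) (R y))"
          using i w y by (intro embed_mem_embedded_rows) (simp_all add: R_def)
        moreover have "M y *\<^sub>v design_content a k r b C p \<sigma> d y =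
            M y *\<^sub>v design_content a k r b C p \<sigma> d' y"
          using eq y n by blast
        ultimately have "embed b (r * a) i w \<bullet> design_content a k r b C p \<sigma> d y =
            embed b (r * a) i w \<bullet> design_content a k r b C p \<sigma> d' y"
          unfolding M_def by (simp add: mult_mat_of_rows_vec_eq_iff [OF embedded_rows_carrier])
        then show "w \<bullet> piggyback_content a k r C p (d i) z = w \<bullet> piggyback_content a k r C p (d' i) z"
          using i y(2) by (simp add: design_content_def scalar_prod_embed piggyback_content_eq
              concat_vecs_carrier)
      qed
    qed
  qed
  ultimately show "\<exists>M. (\<forall>y\<in>{1..n} - {x}. M y \<in> carrier_mat (b * a + lam * ((r - 1) * a)) (design_node_size a r b)) \<and>
      determines (design_data a k r b) ({1..n} - {x})
        (\<lambda>d y. M y *\<^sub>v design_content a k r b C p \<sigma> d y) (\<lambda>d. design_content a k r b C p \<sigma> d x)"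
    by blast
qed

theorem theorem3:
  fixes C :: "nat \<Rightarrow> nat \<Rightarrow> 'f::{field,finite} mat"
    and p \<sigma> :: "nat \<Rightarrow> nat \<Rightarrow> nat"
    and A :: "nat \<Rightarrow> nat set"
    and a k r n b lam \<alpha> :: nat
  assumes "1 \<le> k" and "2 \<le> r" and "n = k + r"
    and "bibd n r lam b A"
    and "msr_code a k r C"
    and "piggyback_scheme r p"
    and "placement k r b A \<sigma>"
    and "\<alpha> = design_node_size a r b"
  shows "\<exists>\<beta>::nat.
      real \<beta> = ((real r - 1)\<^sup>2 / (real n * (real n - 1)) + 1 / real r) * real \<alpha> \<and>
      real \<beta> = (1 + real r * (real r - 1)\<^sup>2 / (real n * (real n - 1))) * (real \<alpha> / real r) \<and>
      balanced_download (design_data a k r b) n \<alpha> (design_content a k r b C p \<sigma>) \<beta>"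
proof (intro exI conjI)
  let ?\<beta> = "b * a + lam * ((r - 1) * a)"
  \<comment> \<open>Counting at the point \<open>1\<close> of the design relates \<open>lam\<close>
    to \<open>b\<close>, which lets the extra download be written as a fraction of \<alpha>.\<close>
  have "b * (r * (r - 1)) = lam * (n * (n - 1))"
    using bibd_counts(3) [OF assms(4), of 1] assms(2,3) by simp
  then have "real (b * (r * (r - 1))) = real (lam * (n * (n - 1)))" by (simp only:)
  then have count: "real b * (real r * (real r - 1)) = real lam * (real n * (real n - 1))"
    using assms(2,3) by (simp add: of_nat_diff)
  have pos: "real n * (real n - 1) \<noteq> 0" "real r > 0" using assms(2,3) by simp_all
  \<comment> \<open>Since \<alpha> is \<open>b * (r * a)\<close>, one factor \<open>r - 1\<close> is
    grouped with \<open>b * r\<close> to match the left side of \<open>count\<close>; then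
    \<open>n * (n - 1)\<close> cancels.\<close>
  have "(real r - 1)\<^sup>2 / (real n * (real n - 1)) * real \<alpha> =
      real b * (real r * (real r - 1)) / (real n * (real n - 1)) * (real r - 1) * real a"
    using assms(8) by (simp add: design_node_size_def power2_eq_square)
  also have "\<dots> = real lam * (real r - 1) * real a"
    unfolding count nonzero_mult_div_cancel_right [OF pos(1)] by simp
  finally have pig: "(real r - 1)\<^sup>2 / (real n * (real n - 1)) * real \<alpha> =
      real lam * (real r - 1) * real a" .
  have "real \<alpha> / real r = real b * real a"
    using assms(8) pos(2) by (simp add: design_node_size_def)
  then show first: "real ?\<beta> = ((real r - 1)\<^sup>2 / (real n * (real n - 1)) + 1 / real r) * real \<alpha>"
    using pig assms(2) by (simp add: distrib_right of_nat_diff)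
  show "real ?\<beta> = (1 + real r * (real r - 1)\<^sup>2 / (real n * (real n - 1))) * (real \<alpha> / real r)"
    unfolding first using pos(2) by (simp add: algebra_simps)
  show "balanced_download (design_data a k r b) n \<alpha> (design_content a k r b C p \<sigma>) ?\<beta>"
    using design_balanced_download [of r n k lam b A a C p \<sigma>] assms by simp
qed

end
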